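(* Let $k\ge3$ be a fixed integer. For every $\varepsilon>0$ there exists $d_0=d_0(k,\varepsilon)$ such that every $C_k$-free graph $G$ of average degree $d\ge d_0$ satisfies $$\alpha(G)\ge(1-\varepsilon)\,\frac{\log d}{d}\,|V(G)|.$$
   Context: Graphs are finite and simple; the average degree of $G$ is $2|E(G)|/|V(G)|$, $\alpha(G)$ is the independence number, and $\log$ is the natural logarithm. $C_k$ is the cycle on $k$ vertices. A graph is $C_k$-free if it contains no (not necessarily induced) subgraph isomorphic to $C_k$. *)

theory Defs
  imports Complex_Main "Graph_Theory.Graph_Theory"
begin

text \<open>
  A finite simple graph is a \<^term>\<open>G :: 'a pair_pre_digraph\<close> satisfying \<^locale>\<open>pair_graph\<close>:
  a finite vertex set with a symmetric and irreflexive set of arcs. An undirected edge is then a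
  pair of opposite arcs, so edges have to be counted as two-element sets, not as arcs.

  The vertex type is arbitrary. A bound that may depend on \<^typ>\<open>'a\<close> is still uniform over all
  finite graphs, since up to isomorphism they all live on the instance \<^typ>\<open>nat\<close>.
\<close>

definition edges :: "'a pair_pre_digraph \<Rightarrow> 'a set set" where
  "edges G = {{u, v} | u v. (u, v) \<in> parcs G}"

definition average_degree :: "'a pair_pre_digraph \<Rightarrow> real" where
  "average_degree G = 2 * real (card (edges G)) / real (card (pverts G))"

definition independent_set :: "'a pair_pre_digraph \<Rightarrow> 'a set \<Rightarrow> bool" where
  "independent_set G S \<longleftrightarrow> S \<subseteq> pverts G \<and> (\<forall>u \<in> S. \<forall>v \<in> S. (u, v) \<notin> parcs G)"

definition independence_number :: "'a pair_pre_digraph \<Rightarrow> nat" where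
  "independence_number G = Max (card ` {S. independent_set G S})"

text \<open>
  The cycle on the vertices \<open>0, \<dots>, k - 1\<close>. It is only meaningful for \<open>k \<ge> 3\<close>.
\<close>

definition cycle_graph :: "nat \<Rightarrow> nat pair_pre_digraph" where
  "cycle_graph k =
    \<lparr> pverts = {..<k},
      parcs = {(i, j). i < k \<and> j < k \<and> (j = Suc i mod k \<or> i = Suc j mod k)} \<rparr>"

text \<open>
  Here \<^const>\<open>subgraph\<close> does not require the subgraph to be induced. No symmetry of \<open>H\<close> has to be
  demanded, since it is inherited from \<open>F\<close> along the isomorphism.
\<close>

definition contains_copy :: "'b pair_pre_digraph \<Rightarrow> 'a pair_pre_digraph \<Rightarrow> bool" where
  "contains_copy F G \<longleftrightarrow>
    (\<exists>H :: 'a pair_pre_digraph.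
       subgraph (with_proj H) (with_proj G) \<and> digraph_iso (with_proj F) (with_proj H))"

definition cycle_free :: "nat \<Rightarrow> 'a pair_pre_digraph \<Rightarrow> bool" where
  "cycle_free k G \<longleftrightarrow> \<not> contains_copy (cycle_graph k) G"

lemma pair_graph_cycle_graph:
  assumes "3 \<le> k"
  shows "pair_graph (cycle_graph k)"
proof
  show "finite (parcs (cycle_graph k))"
    by (rule finite_subset[of _ "{..<k} \<times> {..<k}"]) (auto simp: cycle_graph_def)
  show "fst e \<noteq> snd e" if "e \<in> parcs (cycle_graph k)" for e
    using that assms by (auto simp: cycle_graph_def mod_Suc split: if_splits)
qed (auto simp: cycle_graph_def symmetric_def sym_def)

lemma contains_copy_iff:
  assumes F: "pair_wf_digraph F" and G: "pair_wf_digraph G"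
  shows "contains_copy F G \<longleftrightarrow>
    (\<exists>f. inj_on f (pverts F) \<and> f ` pverts F \<subseteq> pverts G \<and>
         (\<forall>u v. (u, v) \<in> parcs F \<longrightarrow> (f u, f v) \<in> parcs G))"
proof
  assume "contains_copy F G"
  then obtain H h where sub: "subgraph (with_proj H) (with_proj G)"
    and iso: "pre_digraph.digraph_isomorphism (with_proj F) h"
    and H: "with_proj H = app_iso h (with_proj F)"
    unfolding contains_copy_def digraph_iso_def by blast
  have V: "pverts H = iso_verts h ` pverts F" and A: "parcs H = iso_arcs h ` parcs F"
    and t: "iso_tail h = fst" and hd: "iso_head h = snd"
    using H by (auto simp: with_proj_def app_iso_def)
  have arc: "iso_arcs h (u, v) = (iso_verts h u, iso_verts h v)" if "(u, v) \<in> parcs F" for u v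
    using iso that t hd by (force simp: pre_digraph.digraph_isomorphism_def intro: prod_eqI)
  have "(iso_verts h u, iso_verts h v) \<in> parcs G" if "(u, v) \<in> parcs F" for u v
    using arc[OF that] that sub A by (force simp: subgraph_def)
  moreover have "inj_on (iso_verts h) (pverts F)"
    using iso by (simp add: pre_digraph.digraph_isomorphism_def)
  moreover have "iso_verts h ` pverts F \<subseteq> pverts G"
    using sub V by (simp add: subgraph_def)
  ultimately show "\<exists>f. inj_on f (pverts F) \<and> f ` pverts F \<subseteq> pverts G \<and>
      (\<forall>u v. (u, v) \<in> parcs F \<longrightarrow> (f u, f v) \<in> parcs G)"
    by blast
next
  assume "\<exists>f. inj_on f (pverts F) \<and> f ` pverts F \<subseteq> pverts G \<and>
      (\<forall>u v. (u, v) \<in> parcs F \<longrightarrow> (f u, f v) \<in> parcs G)"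
  then obtain f where inj: "inj_on f (pverts F)" and V: "f ` pverts F \<subseteq> pverts G"
    and A: "\<And>u v. (u, v) \<in> parcs F \<Longrightarrow> (f u, f v) \<in> parcs G"
    by (elim exE conjE) (rule that, auto)
  interpret F: pair_wf_digraph F by fact
  define H where "H = \<lparr> pverts = f ` pverts F, parcs = map_prod f f ` parcs F \<rparr>"
  define h where "h = \<lparr> iso_verts = f, iso_arcs = map_prod f f, iso_head = snd, iso_tail = fst \<rparr>"
  have "pair_wf_digraph H"
    by unfold_locales (auto simp: H_def dest: F.wellformed')
  then have "subgraph (with_proj H) (with_proj G)"
    using G V A by (auto simp: subgraph_def compatible_def wf_digraph_wp_iff H_def)
  moreover have "inj_on (map_prod f f) (parcs F)"
    by (rule inj_on_subset[OF map_prod_inj_on[OF inj inj]]) (auto dest: F.wellformed')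
  then have "pre_digraph.digraph_isomorphism (with_proj F) h"
    using inj F by (auto simp: pre_digraph.digraph_isomorphism_def h_def wf_digraph_wp_iff)
  moreover have "with_proj H = app_iso h (with_proj F)"
    by (simp add: with_proj_def app_iso_def H_def h_def)
  ultimately show "contains_copy F G"
    unfolding contains_copy_def digraph_iso_def by blast
qed

end

theory Submission
  imports Defs
begin

text \<open>
  In a \<open>C\<^sub>k\<close>-free graph no neighbourhood contains a path on \<open>k - 1\<close> vertices, since
  such a path closes up through its centre to a cycle of length \<open>k\<close>. A finite graph without
  such a path is \<open>(k - 3)\<close>-degenerate, so the neighbourhood of \<open>v\<close> spans at most
  \<open>a * deg v\<close> arcs with the constant \<open>a = 2 * (k - 3)\<close>. Deleting vertices preserves
  this property, and the property is all that the rest of the argument uses.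

  The lower bound on the independence number follows Shearer's induction for triangle-free graphs.
  One looks for a convex decreasing function \<open>f\<close> such that every graph with \<open>n\<close>
  vertices and average degree \<open>d\<close> has an independent set of size \<open>n * f d\<close>. Put a
  vertex \<open>v\<close> into the independent set and delete \<open>v\<close> and its neighbours. By convexity
  the bound for the remaining graph may be replaced by the tangent of \<open>f\<close> at \<open>d\<close>,
  which is linear in the numbers of vertices and of arcs that remain, and so can be averaged over all
  \<open>v\<close>. The average number of deleted arcs is governed by the sum of the squares of the
  degrees, which is at least \<open>n * d\<^sup>2\<close>, with a correction of at most
  \<open>a * n * d\<close> for arcs inside neighbourhoods. Some choice of \<open>v\<close> therefore makes the
  induction work as soon as
  \<open>(d + 1) * f d + (d\<^sup>2 - (a + 1) * d) * f' d \<le> 1\<close>.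

  The optimal \<open>f\<close> solves this with equality and is in general an integral without a closed
  form. Since a factor \<open>1 - \<epsilon>\<close> may be lost, an explicit function suffices: for
  \<open>F s = ln (1 + s) / s\<close> one has
  \<open>s * F s + s\<^sup>2 * F' s = s / (1 + s) < 1\<close>, so stretching \<open>F\<close> by a large
  constant \<open>K\<close> turns all terms of lower order into a relative error of
  \<open>O((a + 2) / K)\<close>. The resulting bound (\<open>independence_number_cycle_free\<close>) is
  \<open>n * F (d / K) / (K + a + 2)\<close>, and it remains to choose \<open>K\<close> of order
  \<open>(a + 2) / \<epsilon>\<close> and let \<open>d\<close> tend to infinity.
\<close>

section \<open>Counting arcs between vertex sets\<close>

definition arcs_between :: "('a \<times> 'a) set \<Rightarrow> 'a set \<Rightarrow> 'a set \<Rightarrow> nat" where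
  "arcs_between A X Y = card (A \<inter> X \<times> Y)"

text \<open>
  The induction passes to smaller and smaller vertex sets, so the arc set \<open>A\<close> stays fixed and
  the induced subgraph is given by its vertex set \<open>U\<close> alone.
\<close>

definition nbrs :: "('a \<times> 'a) set \<Rightarrow> 'a set \<Rightarrow> 'a \<Rightarrow> 'a set" where
  "nbrs A U v = {w \<in> U. (v, w) \<in> A}"

lemma finite_nbrs [simp]: "finite U \<Longrightarrow> finite (nbrs A U v)"
  by (simp add: nbrs_def)

lemma arcs_between_eq_sum:
  assumes "finite X" "finite Y"
  shows "arcs_between A X Y = (\<Sum>v\<in>X. card (nbrs A Y v))"
proof -
  have "A \<inter> X \<times> Y = Sigma X (nbrs A Y)"
    by (auto simp: nbrs_def)
  with assms show ?thesis
    by (simp add: arcs_between_def)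
qed

lemma arcs_between_commute:
  assumes "sym A"
  shows "arcs_between A X Y = arcs_between A Y X"
  unfolding arcs_between_def
proof (rule bij_betw_same_card)
  show "bij_betw prod.swap (A \<inter> X \<times> Y) (A \<inter> Y \<times> X)"
    using assms by (intro bij_betw_byWitness[where f' = prod.swap]) (auto dest: symD)
qed

lemma arcs_between_Un:
  assumes "finite X" "finite Y" "finite Z" "X \<inter> Y = {}"
  shows "arcs_between A (X \<union> Y) Z = arcs_between A X Z + arcs_between A Y Z"
  using assms by (simp add: arcs_between_eq_sum sum.union_disjoint)

lemma arcs_between_diff:
  assumes "finite U" "W \<subseteq> U" "sym A"
  shows "arcs_between A U U + arcs_between A W W =
    arcs_between A (U - W) (U - W) + 2 * arcs_between A W U"
proof -
  have fin: "finite W" "finite (U - W)"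
    using assms by (auto intro: finite_subset)
  have split: "arcs_between A U Z = arcs_between A W Z + arcs_between A (U - W) Z"
    if "finite Z" for Z
    using arcs_between_Un[of W "U - W" Z A] fin that assms by (simp add: Un_absorb1)
  show ?thesis
    using split[of U] split[of W] split[of "U - W"] assms fin
      arcs_between_commute[OF assms(3), of U W] arcs_between_commute[OF assms(3), of "U - W" W]
      arcs_between_commute[OF assms(3), of U "U - W"]
    by simp
qed

text \<open>
  The arcs at the closed neighbourhood of \<open>v\<close> are counted by twice the degree sum over it, less
  the arcs inside it, which are then counted twice. The contribution of \<open>v\<close> itself
  cancels: it adds \<open>2 * deg v\<close> to either count.
\<close>

lemma arcs_delete_closed_nbhd:
  assumes "finite U" "sym A" "irrefl A" "v \<in> U"
  shows "real (arcs_between A (U - insert v (nbrs A U v)) (U - insert v (nbrs A U v))) =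
    real (arcs_between A U U) - 2 * (\<Sum>w\<in>nbrs A U v. real (card (nbrs A U w)))
      + real (arcs_between A (nbrs A U v) (nbrs A U v))"
proof -
  let ?N = "nbrs A U v"
  have fin: "finite ?N" and v: "v \<notin> ?N"
    using assms by (auto simp: nbrs_def irrefl_def)
  have star: "nbrs A ?N v = ?N" "nbrs A {v} v = {}"
    using assms by (auto simp: nbrs_def irrefl_def)
  have ins: "arcs_between A (insert v ?N) Z = card (nbrs A Z v) + arcs_between A ?N Z"
    if "finite Z" for Z
    using fin v that by (simp add: arcs_between_eq_sum)
  have "arcs_between A {v} {v} = 0" "arcs_between A {v} ?N = card ?N"
    using star fin by (simp_all add: arcs_between_eq_sum)
  moreover have "arcs_between A ?N (insert v ?N) = arcs_between A (insert v ?N) ?N"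
    by (rule arcs_between_commute[OF assms(2)])
  moreover have "nbrs A (insert v ?N) v = ?N"
    using assms by (auto simp: nbrs_def irrefl_def)
  ultimately have "arcs_between A (insert v ?N) (insert v ?N) =
      2 * card ?N + arcs_between A ?N ?N"
    using ins[of "insert v ?N"] ins[of ?N] fin star by simp
  moreover have "arcs_between A (insert v ?N) U = card ?N + arcs_between A ?N U"
    using ins[of U] assms by simp
  moreover have "arcs_between A U U + arcs_between A (insert v ?N) (insert v ?N) =
      arcs_between A (U - insert v ?N) (U - insert v ?N) + 2 * arcs_between A (insert v ?N) U"
    using assms by (intro arcs_between_diff) (auto simp: nbrs_def)
  moreover have "real (arcs_between A ?N U) = (\<Sum>w\<in>?N. real (card (nbrs A U w)))"
    using fin assms by (simp add: arcs_between_eq_sum)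
  ultimately show ?thesis
    by linarith
qed

lemma sum_degree_nbrs:
  assumes "finite U" "sym A"
  shows "(\<Sum>v\<in>U. \<Sum>w\<in>nbrs A U v. real (card (nbrs A U w))) = (\<Sum>w\<in>U. (real (card (nbrs A U w)))\<^sup>2)"
proof -
  have "(\<Sum>v\<in>U. \<Sum>w | w \<in> U \<and> (v, w) \<in> A. real (card (nbrs A U w))) =
      (\<Sum>w\<in>U. \<Sum>v | v \<in> U \<and> (v, w) \<in> A. real (card (nbrs A U w)))"
    using assms(1) by (intro sum.swap_restrict) auto
  also have "{v. v \<in> U \<and> (v, w) \<in> A} = nbrs A U w" for w
    using assms(2) by (auto simp: nbrs_def dest: symD)
  then have "(\<Sum>w\<in>U. \<Sum>v | v \<in> U \<and> (v, w) \<in> A. real (card (nbrs A U w))) =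
      (\<Sum>w\<in>U. (real (card (nbrs A U w)))\<^sup>2)"
    by (simp add: power2_eq_square)
  finally show ?thesis
    by (simp add: nbrs_def)
qed

section \<open>The profile function\<close>

text \<open>
  The value at \<open>0\<close> is the continuous extension. The tangent inequality at a point
  \<open>s > 0\<close> has to hold up to \<open>0\<close>, because deleting vertices may leave a graph without
  arcs.
\<close>

definition profile :: "real \<Rightarrow> real" where
  "profile s = (if s = 0 then 1 else ln (1 + s) / s)"

text \<open>
  The derivative \<open>F'\<close> of the profile \<open>F\<close> at \<open>s > 0\<close>, written so that
  \<open>s * F s + s\<^sup>2 * F' s\<close> visibly collapses to \<open>s / (1 + s)\<close>.
\<close>

definition profile_slope :: "real \<Rightarrow> real" where
  "profile_slope s = (1 / (1 + s) - profile s) / s"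

lemma profile_bounds:
  assumes "0 \<le> s"
  shows "profile s \<le> 1" "1 / (1 + s) \<le> profile s"
proof -
  show "profile s \<le> 1"
    using assms ln_add_one_self_le_self[of s] by (auto simp: profile_def)
  show "1 / (1 + s) \<le> profile s"
  proof (cases "s = 0")
    case False
    then have "s / (1 + s) \<le> ln (1 + s)"
      using assms ln_one_minus_pos_upper_bound[of "s / (1 + s)"] ln_div[of 1 "1 + s"]
      by (simp add: field_simps)
    then show ?thesis
      using assms False by (simp add: profile_def field_simps)
  qed (simp add: profile_def)
qed

text \<open>
  The profile is the integral of \<open>1 / (1 + s * t)\<close> over \<open>t\<close> from \<open>0\<close> to
  \<open>1\<close>, hence convex as an average of convex functions of \<open>s\<close>. The function
  \<open>\<Phi>\<close> in the proof is the antiderivative in \<open>t\<close> of the gap between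
  \<open>1 / (1 + y * t)\<close> and the tangent at \<open>s\<close> of \<open>x \<mapsto> 1 / (1 + x * t)\<close>.
  That gap is a square over a positive number, so \<open>\<Phi>\<close> increases from \<open>0\<close>, and its
  value at \<open>1\<close> is the gap for the profile.
\<close>

lemma profile_tangent:
  assumes s: "0 < s" and y: "0 \<le> y"
  shows "profile s + profile_slope s * (y - s) \<le> profile y"
proof -
  define P where "P = (\<lambda>t. if y = 0 then t else ln (1 + y * t) / y)"
  define \<Phi> where "\<Phi> = (\<lambda>t. P t - ln (1 + s * t) / s
    + (y - s) / s\<^sup>2 * (ln (1 + s * t) + 1 / (1 + s * t) - 1))"
  have dP: "(P has_real_derivative 1 / (1 + y * t)) (at t)" if "0 \<le> t" for t
  proof (cases "y = 0")
    case False
    have "0 < 1 + y * t"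
      using y that by (simp add: add_pos_nonneg)
    then show ?thesis
      unfolding P_def using False by (auto intro!: derivative_eq_intros)
  qed (simp add: P_def)
  have d\<Phi>: "\<exists>D. (\<Phi> has_real_derivative D) (at t) \<and> 0 \<le> D" if "0 \<le> t" for t
  proof -
    define a b where "a = 1 + s * t" and "b = 1 + y * t"
    have a: "0 < a" and b: "0 < b"
      using s y that by (simp_all add: a_def b_def add_pos_nonneg)
    have "(\<Phi> has_real_derivative (1 / b - s / a / s + (y - s) / s\<^sup>2 * (s / a - s / a\<^sup>2))) (at t)"
      unfolding \<Phi>_def b_def using a s
      by (auto intro!: derivative_eq_intros dP[OF that] simp: a_def power2_eq_square)
    moreover have "(y - s) / s\<^sup>2 * (s / a - s / a\<^sup>2) = (b - a) / a\<^sup>2"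
    proof -
      have "(y - s) / s\<^sup>2 * (s / a - s / a\<^sup>2) = (y - s) * ((a - 1) / s) / a\<^sup>2"
        using a s by (simp add: field_simps power2_eq_square)
      also have "\<dots> = (b - a) / a\<^sup>2"
        using s by (simp add: a_def b_def algebra_simps)
      finally show ?thesis .
    qed
    moreover have "1 / b - s / a / s + (b - a) / a\<^sup>2 = (b - a)\<^sup>2 / (a\<^sup>2 * b)"
      using a b s by (simp add: field_simps power2_eq_square)
    ultimately show ?thesis
      using b by (intro exI[of _ "(b - a)\<^sup>2 / (a\<^sup>2 * b)"]) simp
  qed
  have "\<Phi> 0 \<le> \<Phi> 1"
    by (rule DERIV_nonneg_imp_nondecreasing) (use d\<Phi> in auto)
  moreover have "\<Phi> 0 = 0"
    by (simp add: \<Phi>_def P_def)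
  moreover have "\<Phi> 1 = profile y - (profile s + profile_slope s * (y - s))"
  proof -
    have "P 1 = profile y"
      by (simp add: P_def profile_def)
    moreover have "1 / s\<^sup>2 * (ln (1 + s) + 1 / (1 + s) - 1) = - profile_slope s"
      using s by (simp add: profile_slope_def profile_def divide_simps power2_eq_square)
    then have "(y - s) / s\<^sup>2 * (ln (1 + s) + 1 / (1 + s) - 1) = - profile_slope s * (y - s)"
      by (metis (no_types, lifting) mult.assoc mult.commute mult.right_neutral times_divide_eq_left times_divide_eq_right)
    ultimately show ?thesis
      using s by (simp add: \<Phi>_def profile_def[of s])
  qed
  ultimately show ?thesis
    by simp
qed

text \<open>
  With \<open>s = d / K\<close> and \<open>F\<close> for the profile, the left-hand side is \<open>1 / (K + a + 2)\<close> times
  \<open>K * (s / (1 + s)) + F s - (a + 1) * s * F' s\<close>, where the main term is at most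
  \<open>K\<close>, and \<open>F s\<close> and \<open>- s * F' s\<close> are both at most \<open>1\<close>.
\<close>

lemma profile_differential_inequality:
  assumes "0 < K" "0 \<le> a" "0 < d"
  defines "p \<equiv> profile (d / K) / (K + a + 2)"
    and "q \<equiv> profile_slope (d / K) / (K * (K + a + 2))"
  shows "(d + 1) * p + (d\<^sup>2 - (a + 1) * d) * q \<le> 1" "q \<le> 0"
proof -
  define s where "s = d / K"
  have s: "0 < s" and d: "d = K * s"
    using assms by (simp_all add: s_def)
  have slope: "s * profile_slope s = 1 / (1 + s) - profile s"
    using s by (simp add: profile_slope_def)
  have pb: "profile s \<le> 1" "1 / (1 + s) \<le> profile s" "s / (1 + s) \<le> 1"
    using profile_bounds[of s] s by auto
  have "0 \<le> 1 / (1 + s)"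
    using s by simp
  with pb have pb': "profile s - 1 / (1 + s) \<le> 1"
    by linarith
  have "(d + 1) * p + (d\<^sup>2 - (a + 1) * d) * q =
      (K * (s * profile s + s * (s * profile_slope s)) + profile s - (a + 1) * (s * profile_slope s)) / (K + a + 2)"
    using assms(1,2) unfolding p_def q_def s_def[symmetric]
    by (simp add: d divide_simps power2_eq_square) (simp add: algebra_simps)
  also have "\<dots> = (K * (s / (1 + s)) + profile s + (a + 1) * (profile s - 1 / (1 + s))) / (K + a + 2)"
    unfolding slope by (simp add: algebra_simps)
  also have "\<dots> \<le> (K * 1 + 1 + (a + 1) * 1) / (K + a + 2)"
    using assms(1,2) pb pb' by (intro divide_right_mono add_mono mult_left_mono) auto
  also have "\<dots> = 1"
    using assms by simp
  finally show "(d + 1) * p + (d\<^sup>2 - (a + 1) * d) * q \<le> 1" .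
  show "q \<le> 0"
    using pb s assms(1,2) unfolding q_def s_def[symmetric] profile_slope_def
    by (intro divide_nonpos_nonneg) auto
qed

section \<open>Independent sets in graphs with sparse neighbourhoods\<close>

text \<open>
  The averaging step. The right-hand side of the conclusion is the bound obtained from \<open>v\<close> when
  \<open>p\<close> and \<open>q\<close> are the value and the slope of a convex bound at the average degree. Its
  sum over all \<open>v\<close> can be computed up to two estimates: the degrees have mean square at least
  \<open>d\<^sup>2\<close>, and the neighbourhoods are sparse. Both have the right sign because
  \<open>q \<le> 0\<close>: leaving fewer arcs can only help.
\<close>

lemma exists_vertex_good_to_delete:
  fixes A :: "('a \<times> 'a) set" and a p q :: real
  assumes U: "finite U" "U \<noteq> {}" and A: "sym A" "irrefl A"
    and sparse: "\<And>v. v \<in> U \<Longrightarrow>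
      real (arcs_between A (nbrs A U v) (nbrs A U v)) \<le> a * real (card (nbrs A U v))"
    and d: "d = real (arcs_between A U U) / real (card U)"
    and q: "q \<le> 0" and ineq: "(d + 1) * p + (d\<^sup>2 - (a + 1) * d) * q \<le> 1"
  defines "R \<equiv> (\<lambda>v. U - insert v (nbrs A U v))"
  shows "\<exists>v\<in>U. real (card U) * p \<le> 1 + real (card (R v)) * p
    + q * (real (arcs_between A (R v) (R v)) - real (card (R v)) * d)"
proof -
  define n where "n = real (card U)"
  define deg where "deg = (\<lambda>v. real (card (nbrs A U v)))"
  define gain where "gain = (\<lambda>v. 1 + real (card (R v)) * p
    + q * (real (arcs_between A (R v) (R v)) - real (card (R v)) * d))"
  have n: "0 < n"
    using U by (simp add: n_def card_gt_0_iff)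
  have sum_deg: "(\<Sum>v\<in>U. deg v) = n * d"
    using U n by (simp add: deg_def d n_def arcs_between_eq_sum)
  have card_R: "real (card (R v)) = n - 1 - deg v" if "v \<in> U" for v
  proof -
    have "v \<notin> nbrs A U v" "insert v (nbrs A U v) \<subseteq> U"
      using A that by (auto simp: nbrs_def irrefl_def)
    moreover from this have "card (insert v (nbrs A U v)) \<le> card U"
      using U by (intro card_mono) auto
    ultimately show ?thesis
      using U by (simp add: R_def n_def deg_def card_Diff_subset of_nat_diff)
  qed
  have arcs_R: "real (arcs_between A (R v) (R v)) \<le>
      n * d - 2 * (\<Sum>w\<in>nbrs A U v. deg w) + a * deg v" if "v \<in> U" for v
    using arcs_delete_closed_nbhd[OF U(1) A that] sparse[OF that] n
    by (simp add: R_def deg_def n_def d)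
  have swap: "(\<Sum>v\<in>U. \<Sum>w\<in>nbrs A U v. deg w) = (\<Sum>v\<in>U. (deg v)\<^sup>2)"
    using sum_degree_nbrs[OF U(1) A(1)] by (simp add: deg_def)
  have square: "n * d\<^sup>2 \<le> (\<Sum>v\<in>U. (deg v)\<^sup>2)"
  proof -
    have "2 * d * deg v - d\<^sup>2 \<le> (deg v)\<^sup>2" for v
      using zero_le_power2[of "deg v - d"] by (simp add: power2_eq_square algebra_simps)
    then have "(\<Sum>v\<in>U. 2 * d * deg v - d\<^sup>2) \<le> (\<Sum>v\<in>U. (deg v)\<^sup>2)"
      by (intro sum_mono)
    then show ?thesis
      by (simp add: sum_subtractf sum_distrib_left[symmetric] sum_deg n_def[symmetric])
        (simp add: power2_eq_square algebra_simps)
  qed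
  have gain_lb: "1 + (n - 1 - deg v) * p
      + q * (n * d - 2 * (\<Sum>w\<in>nbrs A U v. deg w) + a * deg v - (n - 1 - deg v) * d) \<le> gain v"
    if "v \<in> U" for v
    unfolding gain_def card_R[OF that] using arcs_R[OF that] q
    by (intro add_left_mono mult_left_mono_neg diff_right_mono)
  have "n * (n * p) \<le> n + (n * n - n - n * d) * p
      + q * (n * (n * d) - 2 * (n * d\<^sup>2) + a * (n * d) - (n * n - n - n * d) * d)"
  proof -
    have "n * ((d + 1) * p + (d\<^sup>2 - (a + 1) * d) * q) \<le> n * 1"
      using ineq n by (intro mult_left_mono) auto
    then show ?thesis
      by (simp add: algebra_simps power2_eq_square)
  qed
  also have "\<dots> \<le> n + (n * n - n - n * d) * p
      + q * (n * (n * d) - 2 * (\<Sum>v\<in>U. (deg v)\<^sup>2) + a * (n * d) - (n * n - n - n * d) * d)"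
    using square q by (intro add_left_mono mult_left_mono_neg) auto
  also have "\<dots> = (\<Sum>v\<in>U. 1 + (n - 1 - deg v) * p
      + q * (n * d - 2 * (\<Sum>w\<in>nbrs A U v. deg w) + a * deg v - (n - 1 - deg v) * d))"
    using swap
    by (simp add: sum.distrib sum_subtractf sum_distrib_left[symmetric] sum_distrib_right[symmetric]
        sum_deg n_def[symmetric]) (simp add: algebra_simps)
  also have "\<dots> \<le> (\<Sum>v\<in>U. gain v)"
    by (intro sum_mono gain_lb)
  finally have "n * (n * p) \<le> (\<Sum>v\<in>U. gain v)" .
  moreover have "(\<Sum>v\<in>U. gain v) < n * (n * p)" if "\<And>v. v \<in> U \<Longrightarrow> gain v < n * p"
    using sum_strict_mono[of U gain "\<lambda>_. n * p"] U that by (simp add: n_def)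
  ultimately have "\<exists>v\<in>U. n * p \<le> gain v"
    by (meson not_le)
  then show ?thesis
    by (simp add: gain_def n_def)
qed

text \<open>
  Shearer's induction. If no vertex remains after the deletion, then the average degree of the rest
  is \<open>0 / 0 = 0\<close>, but it is multiplied by the number \<open>0\<close> of vertices, and the tangent
  bound vanishes as well.
\<close>

lemma large_independent_subset:
  fixes A :: "('a \<times> 'a) set" and a K :: real
  assumes "finite U" and A: "sym A" "irrefl A"
    and sparse: "\<And>W v. W \<subseteq> U \<Longrightarrow> v \<in> W \<Longrightarrow>
      real (arcs_between A (nbrs A W v) (nbrs A W v)) \<le> a * real (card (nbrs A W v))"
    and a: "0 \<le> a" and K: "0 < K"
  shows "\<exists>S\<subseteq>U. (\<forall>u\<in>S. \<forall>v\<in>S. (u, v) \<notin> A) \<and>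
    real (card U) * (profile (real (arcs_between A U U) / real (card U) / K) / (K + a + 2)) \<le> real (card S)"
  using assms(1) sparse
proof (induction "card U" arbitrary: U rule: less_induct)
  case less
  define d where "d = real (arcs_between A U U) / real (card U)"
  define p q where "p = profile (d / K) / (K + a + 2)"
    and "q = profile_slope (d / K) / (K * (K + a + 2))"
  have d0: "0 \<le> d"
    by (simp add: d_def)
  show ?case
  proof (cases "d = 0")
    case True
    then have "A \<inter> U \<times> U = {}"
      using less.prems(1) by (auto simp: d_def arcs_between_def card_gt_0_iff)
    then have "\<forall>u\<in>U. \<forall>v\<in>U. (u, v) \<notin> A"
      by blast
    moreover have "real (card U) * (profile (d / K) / (K + a + 2)) \<le> real (card U) * 1"
      using True a K by (intro mult_left_mono) (auto simp: profile_def)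
    ultimately show ?thesis
      by (intro exI[of _ U]) (simp add: d_def)
  next
    case False
    then have d: "0 < d" and U: "U \<noteq> {}"
      using d0 by (auto simp: d_def)
    define R where "R = (\<lambda>v. U - insert v (nbrs A U v))"
    from profile_differential_inequality[OF K a d] obtain v where v: "v \<in> U"
      and gain: "real (card U) * p \<le> 1 + real (card (R v)) * p
        + q * (real (arcs_between A (R v) (R v)) - real (card (R v)) * d)"
      unfolding R_def using exists_vertex_good_to_delete[OF less.prems(1) U A less.prems(2) d_def, of q p]
      by (auto simp: p_def q_def)
    define r e where "r = real (card (R v))" and "e = real (arcs_between A (R v) (R v))"
    have RU: "R v \<subset> U"
      using v by (auto simp: R_def)
    have "card (R v) < card U" "finite (R v)"
      using less.prems(1) RU by (auto intro: psubset_card_mono finite_subset)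
    moreover have "real (arcs_between A (nbrs A W u) (nbrs A W u)) \<le> a * real (card (nbrs A W u))"
      if "W \<subseteq> R v" "u \<in> W" for W u
      using less.prems(2)[of W u] that RU by auto
    ultimately obtain S where S: "S \<subseteq> R v" "\<forall>x\<in>S. \<forall>y\<in>S. (x, y) \<notin> A"
      and card_S: "r * (profile (e / r / K) / (K + a + 2)) \<le> real (card S)"
      using less.hyps[of "R v"] unfolding r_def e_def by blast
    have "r * p + q * (e - r * d) \<le> r * (profile (e / r / K) / (K + a + 2))"
    proof (cases "r = 0")
      case True
      then have "R v = {}"
        using \<open>finite (R v)\<close> by (simp add: r_def)
      then show ?thesis
        using True by (simp add: e_def arcs_between_def)
    next
      case False
      then have r: "0 < r"
        by (simp add: r_def)
      have "profile (d / K) + profile_slope (d / K) * (e / r / K - d / K) \<le> profile (e / r / K)"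
        using d K r by (intro profile_tangent) (auto simp: e_def)
      then have "r * ((profile (d / K) + profile_slope (d / K) * (e / r / K - d / K)) / (K + a + 2))
          \<le> r * (profile (e / r / K) / (K + a + 2))"
        using r K a by (intro mult_left_mono divide_right_mono) auto
      moreover have "r * ((profile (d / K) + profile_slope (d / K) * (e / r / K - d / K)) / (K + a + 2))
          = r * p + q * (e - r * d)"
        using r K a by (simp add: p_def q_def divide_simps)
      ultimately show ?thesis
        by simp
    qed
    then have "real (card U) * p \<le> 1 + real (card S)"
      using gain card_S by (simp add: r_def e_def)
    moreover have "v \<notin> S" "finite S"
      using S(1) \<open>finite (R v)\<close> by (auto simp: R_def intro: finite_subset)
    moreover have "\<forall>x\<in>insert v S. \<forall>y\<in>insert v S. (x, y) \<notin> A"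
      using S A by (auto simp: R_def nbrs_def irrefl_def dest: symD)
    moreover have "insert v S \<subseteq> U"
      using S v by (auto simp: R_def)
    ultimately show ?thesis
      by (intro exI[of _ "insert v S"]) (simp add: p_def d_def)
  qed
qed

section \<open>Neighbourhoods in graphs without a cycle of given length\<close>

text \<open>
  Extend a path greedily at its first vertex \<open>x\<close>: while the path has at most \<open>c\<close>
  vertices, fewer than \<open>c\<close> of them differ from \<open>x\<close>, so some neighbour of \<open>x\<close>
  is still unused.
\<close>

lemma path_from_min_degree:
  assumes "finite T" "T \<noteq> {}" "sym A" "irrefl A"
    and deg: "\<And>v. v \<in> T \<Longrightarrow> c \<le> card (nbrs A T v)"
  shows "\<exists>xs. length xs = Suc c \<and> distinct xs \<and> set xs \<subseteq> T \<and> successively (\<lambda>x y. (x, y) \<in> A) xs"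
proof -
  have "\<exists>xs. length xs = Suc j \<and> distinct xs \<and> set xs \<subseteq> T \<and> successively (\<lambda>x y. (x, y) \<in> A) xs"
    if "j \<le> c" for j
    using that
  proof (induction j)
    case 0
    obtain x where "x \<in> T"
      using assms(2) by blast
    then show ?case
      by (intro exI[of _ "[x]"]) auto
  next
    case (Suc j)
    then obtain xs where len: "length xs = Suc j" and xs: "distinct xs" "set xs \<subseteq> T"
      "successively (\<lambda>x y. (x, y) \<in> A) xs"
      by auto
    then obtain x ys where x: "xs = x # ys" "length ys = j"
      by (cases xs) auto
    have "\<not> nbrs A T x \<subseteq> set ys"
    proof
      assume "nbrs A T x \<subseteq> set ys"
      then have "card (nbrs A T x) \<le> length ys"
        by (meson List.finite_set card_length card_mono le_trans)
      then show False
        using deg[of x] xs x Suc.prems by auto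
    qed
    then obtain y where y: "y \<in> T" "(x, y) \<in> A" "y \<notin> set ys"
      by (auto simp: nbrs_def)
    then have "y \<noteq> x" "(y, x) \<in> A"
      using assms(3,4) by (auto simp: irrefl_def dest: symD)
    then show ?case
      using xs x y by (intro exI[of _ "y # xs"]) auto
  qed
  then show ?thesis
    by blast
qed

text \<open>
  Remove vertices of degree at most \<open>c\<close> one by one; each removal destroys at most
  \<open>2 * c\<close> arcs.
\<close>

lemma arcs_le_of_degenerate:
  assumes "finite S" "sym A" "irrefl A"
    and deg: "\<And>T. T \<subseteq> S \<Longrightarrow> T \<noteq> {} \<Longrightarrow> \<exists>v\<in>T. card (nbrs A T v) \<le> c"
  shows "arcs_between A S S \<le> 2 * c * card S"
  using assms(1) deg
proof (induction "card S" arbitrary: S)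
  case 0
  then show ?case
    by (simp add: arcs_between_def)
next
  case (Suc n)
  then obtain v where v: "v \<in> S" "card (nbrs A S v) \<le> c"
    by (metis card.empty nat.distinct(1) subset_refl)
  have "n = card (S - {v})"
    using Suc v by simp
  then have "arcs_between A (S - {v}) (S - {v}) \<le> 2 * c * n"
    using Suc.hyps(1)[of "S - {v}"] Suc.prems by (metis Diff_subset finite_Diff subset_trans)
  moreover have "arcs_between A {v} S = card (nbrs A S v)"
    using Suc.prems(1) by (simp add: arcs_between_eq_sum)
  moreover have "arcs_between A S S + arcs_between A {v} {v} =
      arcs_between A (S - {v}) (S - {v}) + 2 * arcs_between A {v} S"
    using v Suc.prems(1) assms(2) by (intro arcs_between_diff) auto
  ultimately have "arcs_between A S S \<le> 2 * c * n + 2 * c"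
    using v(2) by linarith
  then show ?case
    by (simp flip: Suc.hyps(2))
qed

lemma pair_graph_sym_irrefl:
  assumes "pair_graph G"
  shows "sym (parcs G)" "irrefl (parcs G)"
proof -
  interpret pair_graph G by fact
  show "sym (parcs G)" "irrefl (parcs G)"
    using sym_arcs no_loops' by (auto simp: symmetric_def irrefl_def)
qed

lemma no_path_in_neighbourhood:
  assumes G: "pair_graph G" and free: "cycle_free k G" and k: "3 \<le> k"
    and xs: "length xs = k - 1" "distinct xs" "set xs \<subseteq> nbrs (parcs G) (pverts G) v"
  shows "\<not> successively (\<lambda>x y. (x, y) \<in> parcs G) xs"
proof
  assume path: "successively (\<lambda>x y. (x, y) \<in> parcs G) xs"
  interpret pair_graph G by fact
  note sym = pair_graph_sym_irrefl(1)[OF G]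
  \<comment> \<open>the centre \<open>v\<close> closes the path to a cycle, as the vertex \<open>k - 1\<close>\<close>
  define f where "f = (\<lambda>i. (xs @ [v]) ! i)"
  have v_notin: "v \<notin> set xs"
    using xs(3) pair_graph_sym_irrefl(2)[OF G] by (auto simp: nbrs_def irrefl_def)
  have f_lt: "f i = xs ! i" if "i < k - 1" for i
    using that xs(1) by (simp add: f_def nth_append)
  have f_last: "f (k - 1) = v"
    using xs(1) by (simp add: f_def nth_append)
  have nbr: "(v, xs ! i) \<in> parcs G" if "i < k - 1" for i
  proof -
    have "xs ! i \<in> nbrs (parcs G) (pverts G) v"
      using that xs(1,3) nth_mem[of i xs] by (metis subsetD)
    then show ?thesis
      by (simp add: nbrs_def)
  qed
  have step: "(f i, f (Suc i mod k)) \<in> parcs G" if i: "i < k" for i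
  proof -
    consider "Suc i < k - 1" | "Suc i = k - 1" | "i = k - 1"
      using i by linarith
    then show ?thesis
    proof cases
      case 1
      then show ?thesis
        using xs(1) successively_nth[OF path, of i] by (simp add: f_lt)
    next
      case 2
      then have "f i = xs ! i" "Suc i mod k = k - 1"
        using k by (auto simp: f_lt)
      then show ?thesis
        using symD[OF sym nbr[of i]] 2 f_last by simp
    next
      case 3
      then have "Suc i mod k = 0"
        using k by simp
      then show ?thesis
        using nbr[of 0] 3 k f_last by (simp add: f_lt)
    qed
  qed
  interpret C: pair_graph "cycle_graph k"
    by (rule pair_graph_cycle_graph[OF k])
  note cycle = C.pair_wf_digraph_axioms
  have verts: "pverts (cycle_graph k) = {..<k}"
    by (simp add: cycle_graph_def)
  have "inj_on f {..<k}"
    using xs v_notin k unfolding f_def by (intro inj_on_nth) auto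
  moreover have "f ` {..<k} \<subseteq> pverts G"
  proof (rule image_subsetI)
    fix i
    assume "i \<in> {..<k}"
    then show "f i \<in> pverts G"
      using wellformed'(1)[OF step[of i]] by simp
  qed
  moreover have "(f u, f w) \<in> parcs G" if "(u, w) \<in> parcs (cycle_graph k)" for u w
  proof -
    have "u < k" "w < k" "w = Suc u mod k \<or> u = Suc w mod k"
      using that by (simp_all add: cycle_graph_def)
    then show ?thesis
      using step[of u] symD[OF sym step[of w]] by metis
  qed
  ultimately have "contains_copy (cycle_graph k) G"
    unfolding contains_copy_iff[OF cycle pair_wf_digraph_axioms]
    by (intro exI[of _ f]) (simp add: verts)
  with free show False
    by (simp add: cycle_free_def)
qed

text \<open>
  A subset of a neighbourhood with all degrees at least \<open>k - 2\<close> would contain a path on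
  \<open>k - 1\<close> vertices, so every neighbourhood is \<open>(k - 3)\<close>-degenerate.
\<close>

lemma cycle_free_sparse_neighbourhood:
  assumes G: "pair_graph G" and free: "cycle_free k G" and k: "3 \<le> k"
    and W: "W \<subseteq> pverts G" and v: "v \<in> W"
  shows "arcs_between (parcs G) (nbrs (parcs G) W v) (nbrs (parcs G) W v)
    \<le> 2 * (k - 3) * card (nbrs (parcs G) W v)"
proof -
  interpret pair_graph G by fact
  note sym = pair_graph_sym_irrefl(1)[OF G] and irrefl = pair_graph_sym_irrefl(2)[OF G]
  have fin: "finite (nbrs (parcs G) W v)"
    using W by (intro finite_nbrs) (auto intro: finite_subset)
  show ?thesis
  proof (rule arcs_le_of_degenerate[OF fin sym irrefl], rule ccontr)
    fix T
    assume T: "T \<subseteq> nbrs (parcs G) W v" "T \<noteq> {}"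
      and "\<not> (\<exists>u\<in>T. card (nbrs (parcs G) T u) \<le> k - 3)"
    then have "k - 2 \<le> card (nbrs (parcs G) T u)" if "u \<in> T" for u
      using that by fastforce
    then obtain xs where "length xs = Suc (k - 2)" "distinct xs" "set xs \<subseteq> T"
      "successively (\<lambda>x y. (x, y) \<in> parcs G) xs"
      using path_from_min_degree[of T "parcs G" "k - 2"] T fin sym irrefl
      by (meson finite_subset)
    moreover have "Suc (k - 2) = k - 1"
      using k by simp
    moreover have "T \<subseteq> nbrs (parcs G) (pverts G) v"
      using T W by (auto simp: nbrs_def)
    ultimately show False
      using no_path_in_neighbourhood[OF G free k, of xs v] by auto
  qed
qed

section \<open>The independence number of graphs without a cycle of given length\<close>

lemma card_parcs_eq:
  assumes "pair_graph G"
  shows "card (parcs G) = 2 * card (edges G)"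
proof -
  interpret pair_graph G by fact
  note sym = pair_graph_sym_irrefl(1)[OF assms]
  define g where "g = (\<lambda>(u :: 'a, v). {u, v})"
  have img: "g ` parcs G = edges G"
    by (force simp: g_def edges_def)
  have "card {x \<in> parcs G. g x = e} = 2" if "e \<in> edges G" for e
  proof -
    obtain u v where e: "e = {u, v}" and uv: "(u, v) \<in> parcs G"
      using \<open>e \<in> edges G\<close> by (auto simp: edges_def)
    then have "{x \<in> parcs G. g x = e} = {(u, v), (v, u)}"
      using symD[OF sym] by (auto simp: g_def doubleton_eq_iff)
    moreover have "u \<noteq> v"
      using uv no_loops by force
    ultimately show ?thesis
      by simp
  qed
  moreover have "card (parcs G) = (\<Sum>e\<in>g ` parcs G. card {x \<in> parcs G. g x = e})"
    using sum.image_gen[of "parcs G" "\<lambda>_. 1 :: nat" g] by simp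
  ultimately show ?thesis
    by (simp add: img)
qed

lemma average_degree_eq:
  assumes "pair_graph G"
  shows "average_degree G = real (arcs_between (parcs G) (pverts G) (pverts G)) / real (card (pverts G))"
proof -
  interpret pair_graph G by fact
  have "parcs G \<inter> pverts G \<times> pverts G = parcs G"
    using wellformed by force
  then show ?thesis
    by (simp add: average_degree_def arcs_between_def card_parcs_eq[OF assms])
qed

lemma card_le_independence_number:
  assumes "finite (pverts G)" "independent_set G S"
  shows "card S \<le> independence_number G"
proof -
  have "finite {S. independent_set G S}"
    using assms(1) by (auto simp: independent_set_def intro: finite_subset[of _ "Pow (pverts G)"])
  then show ?thesis
    using assms(2) by (auto simp: independence_number_def)
qed

lemma independence_number_cycle_free:
  fixes K :: real
  assumes G: "pair_graph G" and free: "cycle_free k G" and k: "3 \<le> k" and K: "0 < K"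
  shows "real (card (pverts G)) * (profile (average_degree G / K) / (K + 2 * real (k - 3) + 2))
    \<le> real (independence_number G)"
proof -
  interpret pair_graph G by fact
  note sym = pair_graph_sym_irrefl(1)[OF G] and irrefl = pair_graph_sym_irrefl(2)[OF G]
  have sparse: "real (arcs_between (parcs G) (nbrs (parcs G) W v) (nbrs (parcs G) W v))
      \<le> (2 * real (k - 3)) * real (card (nbrs (parcs G) W v))"
    if "W \<subseteq> pverts G" "v \<in> W" for W v
    using of_nat_mono[OF cycle_free_sparse_neighbourhood[OF G free k that], where 'a = real]
    by (simp add: mult.assoc)
  obtain S where S: "S \<subseteq> pverts G" "\<forall>u\<in>S. \<forall>v\<in>S. (u, v) \<notin> parcs G"
    and card_S: "real (card (pverts G)) *
      (profile (average_degree G / K) / (K + 2 * real (k - 3) + 2)) \<le> real (card S)"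
  proof -
    have "finite (pverts G)" "0 \<le> 2 * real (k - 3)"
      by simp_all
    from large_independent_subset[OF this(1) sym irrefl sparse this(2) K] that show thesis
      unfolding average_degree_eq[OF G] by blast
  qed
  have "card S \<le> independence_number G"
    using S by (intro card_le_independence_number) (auto simp: independent_set_def)
  with card_S show ?thesis
    by linarith
qed

text \<open>
  The choice of \<open>K\<close> makes \<open>K / (K + M)\<close> equal to \<open>2 / (2 + \<epsilon>)\<close>. As
  \<open>(1 - \<epsilon>) * (2 + \<epsilon>) = 2 - \<epsilon> - \<epsilon>\<^sup>2\<close>, there is room for losing
  \<open>ln K\<close> in \<open>ln (1 + d / K) \<ge> ln d - ln K\<close> once
  \<open>2 * ln K \<le> \<epsilon> * ln d\<close> and \<open>d \<ge> 1\<close>. The absolute value in the lower bound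
  on \<open>d\<close> secures both.
\<close>

lemma profile_asymptotic:
  fixes M \<epsilon> d :: real
  assumes "0 < M" "0 < \<epsilon>"
  defines "K \<equiv> 2 * M / \<epsilon>"
  assumes d: "exp (2 * \<bar>ln K\<bar> / \<epsilon>) \<le> d"
  shows "(1 - \<epsilon>) * (ln d / d) \<le> profile (d / K) / (K + M)"
proof -
  have K: "0 < K" and KM: "K + M = K * (2 + \<epsilon>) / 2"
    using assms(1,2) by (auto simp: K_def field_simps)
  have d0: "0 < d"
    using d by (meson exp_gt_zero less_le_trans)
  then have ln_d: "2 * \<bar>ln K\<bar> / \<epsilon> \<le> ln d"
    using d by (simp add: ln_ge_iff)
  then have "2 * \<bar>ln K\<bar> \<le> \<epsilon> * ln d"
    using assms(2) by (simp add: field_simps)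
  moreover have "0 \<le> 2 * \<bar>ln K\<bar> / \<epsilon>"
    using assms(2) by simp
  then have "0 \<le> \<epsilon>\<^sup>2 * ln d"
    using ln_d by (intro mult_nonneg_nonneg) auto
  ultimately have "(1 - \<epsilon>) * (2 + \<epsilon>) * ln d \<le> 2 * (ln d - ln K)"
    by (simp add: algebra_simps power2_eq_square)
  also have "\<dots> = 2 * ln (d / K)"
    using d0 K by (simp add: ln_div)
  also have "\<dots> \<le> 2 * ln (1 + d / K)"
    using d0 K by (simp add: add_pos_pos)
  finally have "(1 - \<epsilon>) * ln d \<le> 2 * ln (1 + d / K) / (2 + \<epsilon>)"
    using assms(2) by (simp add: field_simps)
  then have "(1 - \<epsilon>) * ln d / d \<le> 2 * ln (1 + d / K) / (2 + \<epsilon>) / d"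
    using d0 by (intro divide_right_mono) auto
  also have "\<dots> = profile (d / K) / (K + M)"
  proof -
    have "2 * L / (2 + \<epsilon>) / d = L / (d / K) / (K * (2 + \<epsilon>) / 2)" for L
      using K by (simp add: mult.commute)
    then show ?thesis
      using d0 K unfolding KM by (simp add: profile_def)
  qed
  finally show ?thesis
    by simp
qed

theorem corollary2p6:
  fixes k :: nat and \<epsilon> :: real
  assumes "3 \<le> k" and "0 < \<epsilon>"
  shows "\<exists>d\<^sub>0 :: real. \<forall>G :: 'a pair_pre_digraph.
    pair_graph G \<and> cycle_free k G \<and> d\<^sub>0 \<le> average_degree G \<longrightarrow>
      (1 - \<epsilon>) * (ln (average_degree G) / average_degree G) * real (card (pverts G))
        \<le> real (independence_number G)"
proof -
  define M K where "M = 2 * real (k - 3) + 2" and "K = 2 * M / \<epsilon>"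
  have M: "0 < M" and K: "0 < K"
    using assms(2) by (simp_all add: M_def K_def)
  have "(1 - \<epsilon>) * (ln (average_degree G) / average_degree G) * real (card (pverts G))
      \<le> real (independence_number G)"
    if "pair_graph G" "cycle_free k G" and d: "exp (2 * \<bar>ln K\<bar> / \<epsilon>) \<le> average_degree G"
    for G :: "'a pair_pre_digraph"
  proof -
    have "(1 - \<epsilon>) * (ln (average_degree G) / average_degree G) * real (card (pverts G))
        \<le> profile (average_degree G / K) / (K + M) * real (card (pverts G))"
      using profile_asymptotic[OF M assms(2)] d unfolding K_def by (intro mult_right_mono) auto
    also have "\<dots> \<le> real (independence_number G)"
      using independence_number_cycle_free[OF that(1,2) assms(1) K]
      by (simp add: M_def algebra_simps)
    finally show ?thesis .
  qed
  then show ?thesis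
    by blast
qed

end
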